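(* Let $\mathfrak{X}$ be the class of all groups containing a $C$-separating subgroup, and let $\mathfrak{Y}$ be the class of all groups containing a supercomplemented primary cyclic subgroup. Then $\mathfrak{X}$ is a proper subclass of $\mathfrak{Y}$. More concretely, $\mathfrak{X}\subseteq\mathfrak{Y}$, and the holomorph $G$ of the cyclic group of order $8$ belongs to $\mathfrak{Y}\setminus\mathfrak{X}$.
   Context: Groups are not assumed finite. A subgroup $H$ of a group $G$ is complemented in $G$ if there is a subgroup $T\leq G$ with $G=HT$ and $H\cap T=1$. A subgroup $H$ of $G$ is supercomplemented in $G$ if every subgroup of $G$ containing $H$ is complemented in $G$. A $C$-separating subgroup of $G$ is a subgroup $H\neq G$ such that every subgroup of $G$ not contained in $H$ is complemented in $G$. A primary cyclic subgroup is a cyclic subgroup that is a $p$-group for some prime $p$ (i.e. finite of order a power of $p$). The holomorph of a group $A$ is the semidirect product $A\rtimes\mathrm{Aut}(A)$ with the natural action. *)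

theory Defs
  imports "HOL-Algebra.Algebra" "HOL-Computational_Algebra.Primes"
begin

definition complemented_in :: "'a set \<Rightarrow> ('a, 'b) monoid_scheme \<Rightarrow> bool" where
  "complemented_in H G \<longleftrightarrow>
     subgroup H G \<and>
     (\<exists>T. subgroup T G \<and> carrier G = H <#>\<^bsub>G\<^esub> T \<and> H \<inter> T = {\<one>\<^bsub>G\<^esub>})"

definition supercomplemented_in :: "'a set \<Rightarrow> ('a, 'b) monoid_scheme \<Rightarrow> bool" where
  "supercomplemented_in H G \<longleftrightarrow>
     subgroup H G \<and> (\<forall>K. subgroup K G \<longrightarrow> H \<subseteq> K \<longrightarrow> complemented_in K G)"

definition C_separating_subgroup :: "'a set \<Rightarrow> ('a, 'b) monoid_scheme \<Rightarrow> bool" where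
  "C_separating_subgroup H G \<longleftrightarrow>
     subgroup H G \<and> H \<noteq> carrier G \<and>
     (\<forall>K. subgroup K G \<longrightarrow> \<not> K \<subseteq> H \<longrightarrow> complemented_in K G)"

(* The equation on the order forces H to be finite, since infinite sets have cardinality 0.
   The exponent 0, i.e. the trivial subgroup, is allowed. *)
definition primary_cyclic_subgroup :: "'a set \<Rightarrow> ('a, 'b) monoid_scheme \<Rightarrow> bool" where
  "primary_cyclic_subgroup H G \<longleftrightarrow>
     subgroup H G \<and> cyclic_group (G\<lparr>carrier := H\<rparr>) \<and>
     (\<exists>(p::nat) (n::nat). Factorial_Ring.prime p \<and> order (G\<lparr>carrier := H\<rparr>) = p ^ n)"

definition class_X :: "('a, 'b) monoid_scheme set" where
  "class_X = {G. group G \<and> (\<exists>H. C_separating_subgroup H G)}"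

definition class_Y :: "('a, 'b) monoid_scheme set" where
  "class_Y = {G. group G \<and> (\<exists>H. primary_cyclic_subgroup H G \<and> supercomplemented_in H G)}"

definition semidirect_product ::
  "('a, 'c) monoid_scheme \<Rightarrow> ('b, 'd) monoid_scheme \<Rightarrow> ('b \<Rightarrow> 'a \<Rightarrow> 'a) \<Rightarrow> ('a \<times> 'b) monoid" where
  "semidirect_product N Q \<phi> =
     \<lparr>carrier = carrier N \<times> carrier Q,
      monoid.mult = (\<lambda>(n, q) (n', q'). (n \<otimes>\<^bsub>N\<^esub> \<phi> q n', q \<otimes>\<^bsub>Q\<^esub> q')),
      monoid.one = (\<one>\<^bsub>N\<^esub>, \<one>\<^bsub>Q\<^esub>)\<rparr>"

lemma group_semidirect_product:
  assumes N: "group N" and Q: "group Q" and \<phi>: "\<phi> \<in> hom Q (AutoGroup N)"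
  shows "group (semidirect_product N Q \<phi>)"
proof -
  interpret N: group N by (rule N)
  interpret Q: group Q by (rule Q)
  have aut: "\<phi> q \<in> auto N" if "q \<in> carrier Q" for q
    using \<phi> that by (auto simp: hom_def AutoGroup_def)
  have closed: "\<phi> q n \<in> carrier N" if "q \<in> carrier Q" "n \<in> carrier N" for q n
    using aut[OF that(1)] that(2) by (auto simp: auto_def hom_def)
  have mult: "\<phi> q (m \<otimes>\<^bsub>N\<^esub> n) = \<phi> q m \<otimes>\<^bsub>N\<^esub> \<phi> q n"
    if "q \<in> carrier Q" "m \<in> carrier N" "n \<in> carrier N" for q m n
    using aut[OF that(1)] that(2,3) by (auto simp: auto_def hom_def)
  have comp: "\<phi> (q \<otimes>\<^bsub>Q\<^esub> r) n = \<phi> q (\<phi> r n)"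
    if "q \<in> carrier Q" "r \<in> carrier Q" "n \<in> carrier N" for q r n
  proof -
    have "\<phi> (q \<otimes>\<^bsub>Q\<^esub> r) = \<phi> q \<otimes>\<^bsub>AutoGroup N\<^esub> \<phi> r"
      using \<phi> that by (simp add: hom_def)
    also have "\<dots> = compose (carrier N) (\<phi> q) (\<phi> r)"
      using aut[OF that(1)] aut[OF that(2)] by (simp add: AutoGroup_def BijGroup_def auto_def)
    finally show ?thesis using that(3) by (simp add: compose_def)
  qed
  have "\<phi> \<one>\<^bsub>Q\<^esub> = \<one>\<^bsub>AutoGroup N\<^esub>"
    using hom_one[OF \<phi> Q N.AutoGroup] .
  then have one: "\<phi> \<one>\<^bsub>Q\<^esub> n = n" if "n \<in> carrier N" for n
    using that by (simp add: AutoGroup_def BijGroup_def)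
  show ?thesis
  proof (rule groupI)
    fix x assume "x \<in> carrier (semidirect_product N Q \<phi>)"
    then obtain n q where x: "x = (n, q)" "n \<in> carrier N" "q \<in> carrier Q"
      by (auto simp: semidirect_product_def)
    let ?q = "inv\<^bsub>Q\<^esub> q"
    let ?y = "(\<phi> ?q (inv\<^bsub>N\<^esub> n), ?q)"
    have "\<phi> ?q (inv\<^bsub>N\<^esub> n) \<otimes>\<^bsub>N\<^esub> \<phi> ?q n = \<phi> ?q \<one>\<^bsub>N\<^esub>"
      using x mult[of ?q "inv\<^bsub>N\<^esub> n" n] by simp
    also have "\<dots> = \<one>\<^bsub>N\<^esub>"
      using x mult[of ?q "\<one>\<^bsub>N\<^esub>" "\<one>\<^bsub>N\<^esub>"] closed[of ?q "\<one>\<^bsub>N\<^esub>"] by simp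
    finally show "\<exists>y\<in>carrier (semidirect_product N Q \<phi>).
        y \<otimes>\<^bsub>semidirect_product N Q \<phi>\<^esub> x = \<one>\<^bsub>semidirect_product N Q \<phi>\<^esub>"
      using x closed by (intro bexI[of _ ?y]) (auto simp: semidirect_product_def)
  qed (auto simp: semidirect_product_def closed mult comp one N.m_assoc Q.m_assoc)
qed

definition holomorph :: "('a, 'b) monoid_scheme \<Rightarrow> ('a \<times> ('a \<Rightarrow> 'a)) monoid" where
  "holomorph A = semidirect_product A (AutoGroup A) (\<lambda>f. f)"

lemma group_holomorph:
  assumes "group A"
  shows "group (holomorph A)"
  unfolding holomorph_def
  by (rule group_semidirect_product[OF assms group.AutoGroup[OF assms]]) (simp add: hom_def)

end

theory Submission
  imports Defs
begin

text \<open>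
  Let \<open>H\<close> be a C-separating subgroup of \<open>G\<close>. As soon as \<open>x\<close> lies outside \<open>H\<close>, every subgroup
  containing \<open>x\<close> fails to lie in \<open>H\<close> and is therefore complemented, so \<open>\<langle>x\<rangle>\<close> is supercomplemented.
  The inclusion \<open>\<XX> \<subseteq> \<YY>\<close> thus asks for an element of prime power order outside \<open>H\<close>. Both halves
  of that come from Bezout's identity: if two powers of \<open>x\<close> with coprime exponents lie in \<open>H\<close>, so does
  \<open>x\<close>. Hence if \<open>x\<close> had infinite order, one of \<open>x\<^sup>2\<close> and \<open>x\<^sup>3\<close> would lie outside \<open>H\<close> and
  generate a complemented subgroup, which is impossible because two nontrivial subgroups of an infinite
  cyclic group always meet nontrivially (\<open>ord_pos_outside_C_separating\<close>). And an element of least order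
  outside \<open>H\<close> has prime power order, since otherwise it is recovered from two powers of smaller
  order (\<open>ex_prime_power_ord_outside_C_separating\<close>).

  The automorphisms of \<open>\<int>/8\<close> are the multiplications by \<open>1, 3, 5, 7\<close>, and all of them square to the
  identity. Every subgroup of \<open>Aut(\<int>/8)\<close> is therefore complemented, and a complement lifts through the
  projection \<open>\<int>/8 \<rtimes> Aut(\<int>/8) \<rightarrow> Aut(\<int>/8)\<close>: the normal subgroup \<open>\<int>/8\<close> is
  supercomplemented in the holomorph (\<open>supercomplemented_base\<close>).

  On the other hand \<open>z = (4, id)\<close> is central and lies in every nontrivial subgroup of \<open>\<int>/8\<close>. A
  complement of a subgroup \<open>K\<close> containing \<open>z\<close> meets \<open>\<int>/8\<close> trivially, so it embeds into
  \<open>Aut(\<int>/8)\<close>, and then \<open>K\<close> has at least \<open>8\<close> elements (\<open>not_complemented_if_contains_4\<close>). For an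
  involution \<open>x\<close>, the group \<open>{1, z, x, xz}\<close> is too small for that, so a C-separating subgroup would
  contain \<open>x\<close> (\<open>involution_in_C_separating\<close>). But the involutions generate the holomorph: they
  include all \<open>(0, f)\<close> with \<open>f \<noteq> id\<close> as well as \<open>(1, -1)\<close>, whose product with \<open>(0, -1)\<close> is the generator \<open>(1, id)\<close>
  of \<open>\<int>/8\<close>.
\<close>

section \<open>Groups with a C-separating subgroup\<close>

text \<open>
  Bezout's identity writes \<open>x\<close> as a product of powers of \<open>x\<^sup>m\<close> and \<open>x\<^sup>n\<close>. Contrapositively,
  an element outside \<open>H\<close> keeps at least one of two coprime powers outside \<open>H\<close>.
\<close>

lemma (in group) subgroup_mem_of_coprime_powers:
  assumes H: "subgroup H G" and x: "x \<in> carrier G"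
    and "x [^] (m::nat) \<in> H" "x [^] (n::nat) \<in> H" and "coprime m n"
  shows "x \<in> H"
proof -
  obtain u v :: int where uv: "u * int m + v * int n = 1"
    using bezout_int[of "int m" "int n"] \<open>coprime m n\<close> by auto
  have mem: "x [^] (k * int l) \<in> H" if "x [^] l \<in> H" for k l
  proof -
    have "x [^] (k * int l) = (x [^] l) [^] k"
      using x by (simp add: int_pow_int[symmetric] int_pow_pow mult.commute)
    then show ?thesis
      using subgroup_int_pow_closed[OF H that] by simp
  qed
  have "x [^] (1::int) = x [^] (u * int m) \<otimes> x [^] (v * int n)"
    unfolding uv[symmetric] using x by (rule int_pow_mult)
  then show ?thesis
    using x subgroup.m_closed[OF H mem[OF assms(3)] mem[OF assms(4)]] by (metis int_pow_1)
qed

text \<open>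
  Suppose \<open>x\<close> has infinite order. Some \<open>K = \<langle>x\<^sup>n\<rangle>\<close> with \<open>n \<ge> 2\<close> is not contained in \<open>H\<close>
  and so has a complement \<open>T\<close>. The \<open>T\<close>-component \<open>t\<close> of \<open>x\<close> is again a power of \<open>x\<close>, so \<open>t\<^sup>n\<close>
  lies in \<open>K \<inter> T = 1\<close>, which forces \<open>t = 1\<close> and \<open>x \<in> K\<close>, absurd.
\<close>

lemma (in group) ord_pos_outside_C_separating:
  assumes sep: "C_separating_subgroup H G" and x: "x \<in> carrier G" "x \<notin> H"
  shows "ord x > 0"
proof (rule ccontr)
  assume "\<not> ord x > 0"
  then have inf: "x [^] (k::int) = \<one> \<Longrightarrow> k = 0" for k
    using int_pow_eq_id[OF x(1), of k] by simp
  have H: "subgroup H G"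
    using sep by (simp add: C_separating_subgroup_def)
  have "coprime (2::nat) 3" by simp
  then have "x [^] (2::nat) \<notin> H \<or> x [^] (3::nat) \<notin> H"
    using subgroup_mem_of_coprime_powers[OF H x(1)] x(2) by blast
  then obtain n :: nat where n: "n \<ge> 2" "x [^] n \<notin> H"
    by (elim disjE) (rule that; simp)+
  let ?K = "generate G {x [^] n}"
  have K: "subgroup ?K G"
    using x(1) by (intro generate_is_subgroup) simp
  have "x [^] n \<in> ?K"
    by (simp add: generate.incl)
  with n(2) have "complemented_in ?K G"
    using sep K unfolding C_separating_subgroup_def by blast
  then obtain T where T: "subgroup T G" "carrier G = ?K <#> T" "?K \<inter> T = {\<one>}"
    unfolding complemented_in_def by blast
  from x(1) obtain k t where kt: "k \<in> ?K" "t \<in> T" "x = k \<otimes> t"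
    unfolding T(2) set_mult_def by blast
  have tG: "t \<in> carrier G"
    using kt(2) T(1) subgroup.subset by blast
  have "?K = {(x [^] n) [^] (j::int) | j. j \<in> UNIV}"
    using x(1) by (intro generate_pow) simp
  then obtain j :: int where "k = (x [^] n) [^] j"
    using kt(1) by blast
  then have k: "k = x [^] (int n * j)"
    using x(1) by (simp add: int_pow_int[symmetric] int_pow_pow)
  have "t = inv k \<otimes> x"
    using kt(3) k tG x(1) by (simp add: inv_solve_left)
  also have "\<dots> = x [^] (1 - int n * j)"
    unfolding k using x(1) int_pow_mult[OF x(1), of "- (int n * j)" 1]
    by (simp add: int_pow_neg)
  finally have t: "t = x [^] (1 - int n * j)" .
  \<comment> \<open>\<open>t\<^sup>n\<close> is a power of \<open>x\<^sup>n\<close> as well as of \<open>t\<close>, hence in the trivial intersection.\<close>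
  have tn: "t [^] int n = (x [^] n) [^] (1 - int n * j)"
    unfolding t using x(1) by (simp add: int_pow_int[symmetric] int_pow_pow mult.commute)
  have "t [^] int n \<in> ?K"
    unfolding tn using subgroup_int_pow_closed[OF K \<open>x [^] n \<in> ?K\<close>] .
  moreover have "t [^] int n \<in> T"
    using subgroup_int_pow_closed[OF T(1) kt(2)] .
  ultimately have "t [^] int n = \<one>"
    using T(3) by blast
  then have "x [^] ((1 - int n * j) * int n) = \<one>"
    unfolding t using x(1) by (simp add: int_pow_pow)
  then have "(1 - int n * j) * int n = 0"
    by (rule inf)
  then have "int n * j = 1"
    using n(1) by simp
  then show False
    using n(1) by (simp add: zmult_eq_1_iff)
qed

text \<open>
  An element \<open>x\<close> of least order outside \<open>H\<close> works: if its order is \<open>p\<^sup>k m\<close> with \<open>k > 0\<close>, \<open>m > 1\<close>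
  and \<open>p\<close> not dividing \<open>m\<close>, then \<open>x\<close> raised to the powers \<open>p\<^sup>k\<close> and \<open>m\<close> has smaller order, so
  both powers lie in \<open>H\<close>, and with them \<open>x\<close>.
\<close>

lemma (in group) ex_prime_power_ord_outside_C_separating:
  assumes sep: "C_separating_subgroup H G"
  obtains x p k where "x \<in> carrier G" "x \<notin> H" "Factorial_Ring.prime p" "ord x = p ^ k"
proof -
  have H: "subgroup H G" and "H \<noteq> carrier G"
    using sep by (simp_all add: C_separating_subgroup_def)
  then obtain y where "y \<in> carrier G \<and> y \<notin> H"
    using subgroup.subset by blast
  then obtain x where x: "x \<in> carrier G" "x \<notin> H"
    and min: "\<And>y. y \<in> carrier G \<Longrightarrow> y \<notin> H \<Longrightarrow> ord x \<le> ord y"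
    using ex_has_least_nat[of "\<lambda>x. x \<in> carrier G \<and> x \<notin> H" y ord] by auto
  have pos: "ord x > 0"
    using sep x by (rule ord_pos_outside_C_separating)
  have "x \<noteq> \<one>"
    using x(2) subgroup.one_closed[OF H] by blast
  then have "ord x \<noteq> 1"
    using ord_eq_1[OF x(1)] by simp
  then obtain p where p: "Factorial_Ring.prime p" "p dvd ord x"
    using prime_factor_nat by blast
  obtain k m where m: "\<not> p dvd m" "ord x = p ^ k * m"
    using divide_out_primepow_ex[of "ord x" "\<lambda>q. q = p"] pos p
    by (auto simp: prime_factors_dvd) blast
  have cop: "coprime (p ^ k) m"
    using p(1) m(1) by (simp add: prime_imp_coprime)
  have "m = 1"
  proof (rule ccontr)
    assume "m \<noteq> 1"
    have "m > 0" using pos m(2) by (cases m) auto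
    have "k > 0" using p(2) m by (cases k) auto
    then have pk: "p ^ k > 1"
      using one_less_power[OF prime_gt_1_nat[OF p(1)]] by blast
    have "ord (x [^] (p ^ k)) = m" "ord (x [^] m) = p ^ k"
      using x(1) m(2) \<open>m > 0\<close> prime_gt_0_nat[OF p(1)] by (auto simp: ord_pow_gen)
    moreover have "m < ord x" "p ^ k < ord x"
      using m(2) pk \<open>m > 0\<close> \<open>m \<noteq> 1\<close> prime_gt_0_nat[OF p(1)] by auto
    ultimately have "x [^] (p ^ k) \<in> H" "x [^] m \<in> H"
      using min[of "x [^] (p ^ k)"] min[of "x [^] m"] x(1) by force+
    with cop have "x \<in> H"
      using subgroup_mem_of_coprime_powers[OF H x(1)] by blast
    with x(2) show False by simp
  qed
  with that x p(1) m(2) show thesis by simp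
qed

lemma (in group) primary_cyclic_subgroup_generate:
  assumes x: "x \<in> carrier G" and p: "Factorial_Ring.prime p" "ord x = p ^ k"
  shows "primary_cyclic_subgroup (generate G {x}) G"
proof -
  have "subgroup_generated G {x} = G\<lparr>carrier := generate G {x}\<rparr>"
    using x by (simp add: subgroup_generated_def)
  then have "cyclic_group (G\<lparr>carrier := generate G {x}\<rparr>)"
    using cyclic_group_generated[of x] by simp
  moreover have "subgroup (generate G {x}) G"
    using x by (intro generate_is_subgroup) simp
  moreover have "order (G\<lparr>carrier := generate G {x}\<rparr>) = p ^ k"
    using generate_pow_card[OF x] p(2) by (simp add: order_def)
  ultimately show ?thesis
    using p(1) unfolding primary_cyclic_subgroup_def by blast
qed

lemma class_X_subset_class_Y: "class_X \<subseteq> class_Y"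
proof
  fix G :: "('a, 'b) monoid_scheme"
  assume "G \<in> class_X"
  then obtain H where "group G" and sep: "C_separating_subgroup H G"
    by (auto simp: class_X_def)
  interpret group G by fact
  obtain x p k where x: "x \<in> carrier G" "x \<notin> H"
    and p: "Factorial_Ring.prime p" "ord x = p ^ k"
    using ex_prime_power_ord_outside_C_separating[OF sep] .
  have "complemented_in K G" if "subgroup K G" "generate G {x} \<subseteq> K" for K
  proof -
    have "x \<in> K"
      using that(2) generate.incl[of x "{x}" G] by blast
    with x(2) sep that(1) show ?thesis
      unfolding C_separating_subgroup_def by blast
  qed
  moreover have "subgroup (generate G {x}) G"
    using x(1) by (intro generate_is_subgroup) simp
  ultimately have "supercomplemented_in (generate G {x}) G"
    by (simp add: supercomplemented_in_def)
  then show "G \<in> class_Y"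
    using \<open>group G\<close> primary_cyclic_subgroup_generate[OF x(1) p]
    unfolding class_Y_def by blast
qed

section \<open>Complements in semidirect products\<close>

text \<open>
  Such a group is a vector space over the field with two elements, where subspaces have complements.
  A maximal subgroup \<open>T\<close> with \<open>V \<inter> T = 1\<close> is a complement: for \<open>g\<close> outside \<open>VT\<close>, the larger
  subgroup \<open>T \<union> gT\<close> would still meet \<open>V\<close> trivially, as \<open>gt \<in> V\<close> gives \<open>g \<in> VT\<close>.
\<close>

lemma (in group) complemented_if_all_involutions:
  assumes fin: "finite (carrier G)" and inv2: "\<And>x. x \<in> carrier G \<Longrightarrow> x \<otimes> x = \<one>"
    and V: "subgroup V G"
  shows "complemented_in V G"
proof -
  have inv_self: "inv x = x" if "x \<in> carrier G" for x
    using that inv2 by (simp add: inv_equality)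
  have comm: "x \<otimes> y = y \<otimes> x" if "x \<in> carrier G" "y \<in> carrier G" for x y
    using that inv_mult_group[of x y] inv_self by simp
  let ?\<T> = "{T. subgroup T G \<and> V \<inter> T = {\<one>}}"
  have "finite ?\<T>"
    by (rule finite_subset[of _ "Pow (carrier G)"]) (use fin subgroup.subset in auto)
  moreover have "{\<one>} \<in> ?\<T>"
    using triv_subgroup subgroup.one_closed[OF V] by auto
  ultimately obtain T where T: "T \<in> ?\<T>" and max: "\<And>T'. T' \<in> ?\<T> \<Longrightarrow> T \<subseteq> T' \<Longrightarrow> T = T'"
    using finite_has_maximal[of ?\<T>] by (metis (no_types, lifting) empty_iff)
  have subT: "subgroup T G" and VT: "V \<inter> T = {\<one>}"
    using T by auto
  have VG: "v \<in> carrier G" if "v \<in> V" for v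
    using that V subgroup.subset by blast
  have TG: "t \<in> carrier G" if "t \<in> T" for t
    using that subT subgroup.subset by blast
  have "g \<in> V <#> T" if g: "g \<in> carrier G" for g
  proof (rule ccontr)
    assume out: "g \<notin> V <#> T"
    let ?T' = "T \<union> (\<lambda>t. g \<otimes> t) ` T"
    have gg: "g \<otimes> t \<otimes> (g \<otimes> s) = t \<otimes> s" if "t \<in> T" "s \<in> T" for t s
    proof -
      have "g \<otimes> t \<otimes> (g \<otimes> s) = (g \<otimes> t) \<otimes> g \<otimes> s"
        using g that TG by (simp add: m_assoc)
      also have "\<dots> = g \<otimes> g \<otimes> t \<otimes> s"
        using g that TG comm[of g t] comm[of "g \<otimes> t" g] by (simp add: m_assoc)
      finally show ?thesis
        using g that TG inv2 by simp
    qed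
    have tg: "t \<otimes> (g \<otimes> s) = g \<otimes> (t \<otimes> s)" if "t \<in> T" "s \<in> T" for t s
      using g that TG comm[of t g] by (metis m_assoc)
    have gts: "g \<otimes> t \<otimes> s = g \<otimes> (t \<otimes> s)" if "t \<in> T" "s \<in> T" for t s
      using g that TG by (simp add: m_assoc)
    have "subgroup ?T' G"
    proof (rule subgroupI)
      show "?T' \<subseteq> carrier G" using g TG by auto
      show "?T' \<noteq> {}" using subgroup.one_closed[OF subT] by auto
      show "inv a \<in> ?T'" if "a \<in> ?T'" for a
        using that \<open>?T' \<subseteq> carrier G\<close> inv_self by (metis subsetD)
      show "a \<otimes> b \<in> ?T'" if "a \<in> ?T'" "b \<in> ?T'" for a b
        using that subgroup.m_closed[OF subT]
        by (elim UnE imageE) (simp_all add: gg tg gts)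
    qed
    moreover have "V \<inter> ?T' = {\<one>}"
    proof -
      have "g \<otimes> t \<notin> V" if "t \<in> T" for t
      proof
        assume "g \<otimes> t \<in> V"
        moreover have "g = (g \<otimes> t) \<otimes> t"
          using g that TG inv2 by (simp add: m_assoc)
        ultimately show False
          using out that unfolding set_mult_def by blast
      qed
      then show ?thesis using VT by blast
    qed
    ultimately have "T = ?T'"
      by (intro max) auto
    moreover have "g \<in> ?T'"
      using g subgroup.one_closed[OF subT] by (force intro!: image_eqI[of _ _ "\<one>"])
    ultimately have "g \<in> T" by blast
    then have "\<one> \<otimes> g \<in> V <#> T"
      using subgroup.one_closed[OF V] unfolding set_mult_def by blast
    then show False using out g by simp
  qed
  then have "carrier G = V <#> T"
    using VG TG by (auto simp: set_mult_def)
  then show ?thesis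
    unfolding complemented_in_def using V subT VT by blast
qed

locale semidirect = N: group N + Q: group Q
  for N :: "('a, 'c) monoid_scheme" and Q :: "('b, 'd) monoid_scheme" +
  fixes \<phi> :: "'b \<Rightarrow> 'a \<Rightarrow> 'a"
  assumes action: "\<phi> \<in> hom Q (AutoGroup N)"
begin

abbreviation P where "P \<equiv> semidirect_product N Q \<phi>"

definition base where "base = carrier N \<times> {\<one>\<^bsub>Q\<^esub>}"

sublocale P: group P
  by (rule group_semidirect_product) (unfold_locales, rule action)

lemma carrier_P [simp]: "carrier P = carrier N \<times> carrier Q"
  by (simp add: semidirect_product_def)

lemma one_P [simp]: "\<one>\<^bsub>P\<^esub> = (\<one>\<^bsub>N\<^esub>, \<one>\<^bsub>Q\<^esub>)"
  by (simp add: semidirect_product_def)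

lemma mult_P [simp]: "(n, q) \<otimes>\<^bsub>P\<^esub> (n', q') = (n \<otimes>\<^bsub>N\<^esub> \<phi> q n', q \<otimes>\<^bsub>Q\<^esub> q')"
  by (simp add: semidirect_product_def)

lemma act_hom: "q \<in> carrier Q \<Longrightarrow> \<phi> q \<in> hom N N"
  using action by (auto simp: hom_def AutoGroup_def auto_def)

lemma act_one_N [simp]: "q \<in> carrier Q \<Longrightarrow> \<phi> q \<one>\<^bsub>N\<^esub> = \<one>\<^bsub>N\<^esub>"
  using hom_one[OF act_hom] N.group_axioms by blast

lemma act_one_Q [simp]: "n \<in> carrier N \<Longrightarrow> \<phi> \<one>\<^bsub>Q\<^esub> n = n"
  using hom_one[OF action Q.group_axioms N.AutoGroup]
  by (simp add: AutoGroup_def BijGroup_def)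

lemma inj_hom: "(\<lambda>n. (n, \<one>\<^bsub>Q\<^esub>)) \<in> hom N P"
  by (auto simp: hom_def)

lemma subgroup_base: "subgroup base P"
proof -
  interpret group_hom N P "\<lambda>n. (n, \<one>\<^bsub>Q\<^esub>)"
    by unfold_locales (rule inj_hom)
  have "base = (\<lambda>n. (n, \<one>\<^bsub>Q\<^esub>)) ` carrier N"
    by (auto simp: base_def)
  then show ?thesis using img_is_subgroup by simp
qed

lemma primary_cyclic_base:
  assumes "cyclic_group N" and "Factorial_Ring.prime p" "order N = p ^ k"
  shows "primary_cyclic_subgroup base P"
proof -
  have "(\<lambda>n. (n, \<one>\<^bsub>Q\<^esub>)) \<in> epi N (P\<lparr>carrier := base\<rparr>)"
    by (auto simp: epi_def hom_def base_def)
  then have "cyclic_group (P\<lparr>carrier := base\<rparr>)"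
    using N.cyclic_group_epimorphic_image assms(1) P.subgroup_imp_group[OF subgroup_base]
    by blast
  moreover have "order (P\<lparr>carrier := base\<rparr>) = p ^ k"
    using assms(3) by (simp add: order_def base_def card_cartesian_product)
  ultimately show ?thesis
    using assms(2) subgroup_base unfolding primary_cyclic_subgroup_def by blast
qed

text \<open>
  A subgroup \<open>K\<close> containing the base is the full preimage of its projection \<open>V\<close> to \<open>Q\<close>. So a complement
  \<open>W\<close> of \<open>V\<close> in \<open>Q\<close>, placed in the canonical copy of \<open>Q\<close>, complements \<open>K\<close>.
\<close>

lemma supercomplemented_base:
  assumes compl: "\<And>V. subgroup V Q \<Longrightarrow> complemented_in V Q"
  shows "supercomplemented_in base P"
  unfolding supercomplemented_in_def
proof (intro conjI allI impI subgroup_base)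
  fix K assume K: "subgroup K P" and le: "base \<subseteq> K"
  interpret snd: group_hom P Q snd
    by unfold_locales (auto simp: hom_def)
  have KP: "n \<in> carrier N" "q \<in> carrier Q" if "(n, q) \<in> K" for n q
    using that subgroup.subset[OF K] by auto
  let ?V = "snd ` K"
  have V: "subgroup ?V Q"
    using K by (rule snd.subgroup_img_is_subgroup)
  have full: "(n, q) \<in> K" if nq: "n \<in> carrier N" "q \<in> ?V" for n q
  proof -
    obtain m where m: "(m, q) \<in> K" using nq(2) by auto
    then have "(n \<otimes>\<^bsub>N\<^esub> inv\<^bsub>N\<^esub> m, \<one>\<^bsub>Q\<^esub>) \<in> K"
      using le nq(1) KP[OF m] by (auto simp: base_def)
    then have "(n \<otimes>\<^bsub>N\<^esub> inv\<^bsub>N\<^esub> m, \<one>\<^bsub>Q\<^esub>) \<otimes>\<^bsub>P\<^esub> (m, q) \<in> K"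
      using m subgroup.m_closed[OF K] by blast
    then show ?thesis
      using nq(1) KP[OF m] by (simp add: N.m_assoc)
  qed
  obtain W where W: "subgroup W Q" "carrier Q = ?V <#>\<^bsub>Q\<^esub> W" "?V \<inter> W = {\<one>\<^bsub>Q\<^esub>}"
    using compl[OF V] unfolding complemented_in_def by blast
  have WQ: "w \<in> carrier Q" if "w \<in> W" for w
    using that W(1) subgroup.subset by blast
  let ?T = "{\<one>\<^bsub>N\<^esub>} \<times> W"
  have "subgroup ?T P"
  proof (rule P.subgroupI)
    show "?T \<subseteq> carrier P" using WQ by auto
    show "?T \<noteq> {}" using subgroup.one_closed[OF W(1)] by auto
    fix a b assume a: "a \<in> ?T" and b: "b \<in> ?T"
    show "a \<otimes>\<^bsub>P\<^esub> b \<in> ?T"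
      using a b WQ subgroup.m_closed[OF W(1)] by auto
  next
    fix a assume "a \<in> ?T"
    then obtain w where w: "a = (\<one>\<^bsub>N\<^esub>, w)" "w \<in> W" by auto
    have "inv\<^bsub>P\<^esub> a = (\<one>\<^bsub>N\<^esub>, inv\<^bsub>Q\<^esub> w)"
      using w WQ by (intro P.inv_equality) auto
    then show "inv\<^bsub>P\<^esub> a \<in> ?T"
      using w subgroup.m_inv_closed[OF W(1)] by auto
  qed
  moreover have "carrier P = K <#>\<^bsub>P\<^esub> ?T"
  proof
    show "K <#>\<^bsub>P\<^esub> ?T \<subseteq> carrier P"
      using subgroup.subset[OF K] subgroup.subset[OF \<open>subgroup ?T P\<close>] P.set_mult_closed by blast
    show "carrier P \<subseteq> K <#>\<^bsub>P\<^esub> ?T"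
    proof
      fix x assume "x \<in> carrier P"
      then obtain n q where x: "x = (n, q)" "n \<in> carrier N" "q \<in> carrier Q" by auto
      then obtain v w where vw: "v \<in> ?V" "w \<in> W" "q = v \<otimes>\<^bsub>Q\<^esub> w"
        using W(2) unfolding set_mult_def by blast
      have "v \<in> carrier Q" using vw(1) V subgroup.subset by blast
      then have "x = (n, v) \<otimes>\<^bsub>P\<^esub> (\<one>\<^bsub>N\<^esub>, w)"
        using x vw by simp
      then show "x \<in> K <#>\<^bsub>P\<^esub> ?T"
        using full[OF x(2) vw(1)] vw(2) unfolding set_mult_def by blast
    qed
  qed
  moreover have "K \<inter> ?T = {\<one>\<^bsub>P\<^esub>}"
  proof -
    have "w = \<one>\<^bsub>Q\<^esub>" if "(\<one>\<^bsub>N\<^esub>, w) \<in> K" "w \<in> W" for w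
      using that W(3) by force
    then have "K \<inter> ?T \<subseteq> {\<one>\<^bsub>P\<^esub>}"
      by auto
    then show ?thesis
      using subgroup.one_closed[OF K] subgroup.one_closed[OF \<open>subgroup ?T P\<close>] by blast
  qed
  ultimately show "complemented_in K P"
    unfolding complemented_in_def using K by blast
qed

text \<open>
  The base is the kernel of the projection to \<open>Q\<close>, so the projection is injective on \<open>T\<close>.
\<close>

lemma card_le_of_trivial_Int_base:
  assumes T: "subgroup T P" and triv: "T \<inter> base = {\<one>\<^bsub>P\<^esub>}" and fin: "finite (carrier Q)"
  shows "card T \<le> card (carrier Q)"
proof -
  interpret snd: group_hom P Q snd
    by unfold_locales (auto simp: hom_def)
  have TP: "x \<in> carrier P" if "x \<in> T" for x
    using that subgroup.subset[OF T] by blast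
  have "inj_on snd T"
  proof (rule inj_onI)
    fix x y assume xy: "x \<in> T" "y \<in> T" "snd x = snd y"
    let ?d = "x \<otimes>\<^bsub>P\<^esub> inv\<^bsub>P\<^esub> y"
    have "snd ?d = \<one>\<^bsub>Q\<^esub>"
      using xy TP[OF xy(1)] TP[OF xy(2)] snd.hom_inv[of y] snd.hom_mult[of x "inv\<^bsub>P\<^esub> y"]
        snd.hom_closed[of y] P.inv_closed[of y]
      by (metis Q.r_inv)
    moreover have "?d \<in> T"
      by (intro subgroup.m_closed[OF T] subgroup.m_inv_closed[OF T] xy)
    ultimately have "?d \<in> T \<inter> base"
      using TP[of ?d] by (cases ?d) (auto simp: base_def)
    with triv have "?d = \<one>\<^bsub>P\<^esub>" by blast
    then show "x = y"
      using TP xy P.inv_solve_right' P.r_inv by (metis P.inv_equality P.inv_inv P.inv_closed)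
  qed
  moreover have "snd ` T \<subseteq> carrier Q"
    using TP by force
  ultimately show ?thesis
    using fin by (rule card_inj_on_le)
qed

end

section \<open>The holomorph of the cyclic group of order 8\<close>

abbreviation "Z8 \<equiv> integer_mod_group 8"

lemma carrier_Z8: "carrier Z8 = {0..<8}"
  by (simp add: carrier_integer_mod_group)

lemma auto_Z8_eq_mult:
  assumes f: "f \<in> auto Z8" and n: "n \<in> {0..<8}"
  shows "f n = (n * f 1) mod 8"
proof -
  interpret group_hom Z8 Z8 f
    using f by (auto simp: group_hom_def group_hom_axioms_def auto_def)
  have "f (1 [^]\<^bsub>Z8\<^esub> nat n) = f 1 [^]\<^bsub>Z8\<^esub> nat n"
    by (rule hom_nat_pow) simp
  then show ?thesis using n by simp
qed

text \<open>
  An even multiplier would send \<open>4\<close> to \<open>0\<close>.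
\<close>

lemma auto_Z8_odd:
  assumes f: "f \<in> auto Z8"
  shows "odd (f 1)" "f 1 \<in> {0..<8}"
proof -
  have bij: "bij_betw f {0..<8} {0..<8}"
    using f by (simp add: auto_def Bij_def carrier_Z8)
  then show "f 1 \<in> {0..<8}"
    by (rule bij_betwE[THEN bspec]) simp
  show "odd (f 1)"
  proof
    assume "even (f 1)"
    then have "f 4 = f 0"
      using auto_Z8_eq_mult[OF f, of 4] auto_Z8_eq_mult[OF f, of 0] by (auto elim!: evenE)
    then show False
      using bij by (auto simp: bij_betw_def dest: inj_onD)
  qed
qed

text \<open>
  This makes \<open>(4, id)\<close> central in the holomorph.
\<close>

lemma auto_Z8_fixes_4:
  assumes f: "f \<in> auto Z8"
  shows "f 4 = 4"
  using auto_Z8_eq_mult[OF f, of 4] auto_Z8_odd(1)[OF f] by simp presburger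

text \<open>
  Odd squares are congruent to \<open>1\<close> modulo \<open>8\<close>.
\<close>

lemma auto_Z8_involutive:
  assumes f: "f \<in> auto Z8" and n: "n \<in> {0..<8}"
  shows "f (f n) = n"
proof -
  have fn: "f n = (n * f 1) mod 8"
    using f n by (rule auto_Z8_eq_mult)
  have "f (f n) = (n * f 1 mod 8) * f 1 mod 8"
    using auto_Z8_eq_mult[OF f, of "f n"] fn by simp
  also have "\<dots> = n * (f 1 * f 1 mod 8) mod 8"
    by (simp add: mod_simps mult.assoc)
  also have "f 1 * f 1 mod 8 = 1"
  proof -
    have "f 1 = 1 \<or> f 1 = 3 \<or> f 1 = 5 \<or> f 1 = 7"
      using auto_Z8_odd[OF f] by simp presburger
    then show ?thesis by auto
  qed
  finally show ?thesis using n by simp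
qed

lemma finite_auto_Z8: "finite (auto Z8)"
proof (rule finite_subset)
  show "auto Z8 \<subseteq> {0..<8} \<rightarrow>\<^sub>E {0..<8}"
    by (auto simp: auto_def Bij_def carrier_Z8 PiE_def dest: bij_betwE)
qed (auto intro: finite_PiE)

definition neg8 :: "int \<Rightarrow> int" where "neg8 = (\<lambda>n\<in>{0..<8}. (- n) mod 8)"

lemma neg8_auto: "neg8 \<in> auto Z8"
proof -
  have "bij_betw neg8 {0..<8} {0..<8}"
    by (rule bij_betw_byWitness[where f' = neg8]) (auto simp: neg8_def mod_minus_eq)
  moreover have "neg8 \<in> hom Z8 Z8"
    by (auto simp: hom_def carrier_Z8 neg8_def mod_simps)
  ultimately show ?thesis
    by (auto simp: auto_def Bij_def carrier_Z8 neg8_def)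
qed

interpretation Hol: semidirect Z8 "AutoGroup Z8" "\<lambda>f. f"
  by (intro semidirect.intro semidirect_axioms.intro group.AutoGroup) (auto simp: hom_def)

lemma carrier_AutoGroup: "carrier (AutoGroup G) = auto G"
  by (simp add: AutoGroup_def)

lemma one_AutoGroup: "\<one>\<^bsub>AutoGroup G\<^esub> = (\<lambda>x\<in>carrier G. x)"
  by (simp add: AutoGroup_def BijGroup_def)

lemma mult_AutoGroup:
  "f \<in> auto G \<Longrightarrow> g \<in> auto G \<Longrightarrow> f \<otimes>\<^bsub>AutoGroup G\<^esub> g = compose (carrier G) f g"
  by (simp add: AutoGroup_def BijGroup_def auto_def)

lemma AutoGroup_Z8_involutions:
  assumes "f \<in> auto Z8"
  shows "f \<otimes>\<^bsub>AutoGroup Z8\<^esub> f = \<one>\<^bsub>AutoGroup Z8\<^esub>"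
  using assms auto_Z8_involutive[OF assms]
  by (auto simp: mult_AutoGroup one_AutoGroup compose_def carrier_Z8)

lemma holomorph_Z8_in_class_Y: "holomorph Z8 \<in> class_Y"
proof -
  have "finite (carrier (AutoGroup Z8))"
    by (simp add: carrier_AutoGroup finite_auto_Z8)
  then have "supercomplemented_in Hol.base (holomorph Z8)"
    unfolding holomorph_def using AutoGroup_Z8_involutions
    by (intro Hol.supercomplemented_base Hol.Q.complemented_if_all_involutions)
      (auto simp: carrier_AutoGroup)
  moreover have "cyclic_group Z8"
  proof -
    have "carrier Z8 = range (\<lambda>n::int. 1 [^]\<^bsub>Z8\<^esub> n)"
      by (auto simp: int_pow_integer_mod_group carrier_Z8 image_iff intro!: exI mod_pos_pos_trivial[symmetric])
    then show ?thesis
      unfolding Hol.N.cyclic_group by (intro bexI[of _ 1]) auto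
  qed
  then have "primary_cyclic_subgroup Hol.base (holomorph Z8)"
    unfolding holomorph_def
    by (rule Hol.primary_cyclic_base[where p = 2 and k = 3]) (auto simp: order_def carrier_Z8)
  ultimately show ?thesis
    using group_holomorph[of Z8] unfolding class_Y_def by auto
qed

text \<open>
  Each nonzero element of \<open>\<int>/8\<close> has \<open>4\<close> among its multiples, and a complement \<open>T\<close> of \<open>K\<close> does not
  contain \<open>(4, id)\<close>, so \<open>T\<close> meets the base trivially. Then \<open>T\<close> has at most as many elements as \<open>Aut(\<int>/8)\<close>, and \<open>K\<close> must make up a
  factor of at least \<open>8\<close>.
\<close>

lemma not_complemented_if_contains_4:
  assumes four: "(4, \<one>\<^bsub>AutoGroup Z8\<^esub>) \<in> K" and small: "card K < 8"
  shows "\<not> complemented_in K (holomorph Z8)"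
proof
  let ?e = "\<one>\<^bsub>AutoGroup Z8\<^esub>"
  assume "complemented_in K (holomorph Z8)"
  then obtain T where K: "subgroup K Hol.P" and T: "subgroup T Hol.P"
    and KT: "carrier Hol.P = K <#>\<^bsub>Hol.P\<^esub> T" and triv: "K \<inter> T = {\<one>\<^bsub>Hol.P\<^esub>}"
    unfolding complemented_in_def holomorph_def by blast
  have fin: "finite (carrier (AutoGroup Z8))"
    by (simp add: carrier_AutoGroup finite_auto_Z8)
  then have finP: "finite (carrier Hol.P)"
    by (simp add: carrier_Z8)
  interpret i: group_hom Z8 Hol.P "\<lambda>n. (n, ?e)"
    by unfold_locales (rule Hol.inj_hom)
  have "T \<inter> Hol.base = {\<one>\<^bsub>Hol.P\<^esub>}"
  proof -
    have "n = 0" if n: "n \<in> {0..<8}" "(n, ?e) \<in> T" for n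
    proof (rule ccontr)
      assume "n \<noteq> 0"
      with n(1) have "n = 4 \<or> n = 2 \<or> n = 6 \<or> n = 1 \<or> n = 3 \<or> n = 5 \<or> n = 7"
        by simp presburger
      \<comment> \<open>\<open>k\<close> is \<open>4\<close> divided by the largest power of two dividing \<open>n\<close>.\<close>
      then have "\<exists>k::nat\<in>{1,2,4}. (int k * n) mod 8 = 4"
        by auto
      then obtain k :: nat where k: "(int k * n) mod 8 = 4" by blast
      have "(n, ?e) [^]\<^bsub>Hol.P\<^esub> k = (n [^]\<^bsub>Z8\<^esub> k, ?e)"
        using n(1) i.hom_nat_pow[of n k] by (simp add: carrier_Z8)
      also have "\<dots> = (4, ?e)"
        using k by simp
      finally have "(4, ?e) \<in> T"
        using Hol.P.subgroup_int_pow_closed[OF T n(2), of "int k"]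
        by (simp add: int_pow_int)
      with four have "(4, ?e) \<in> K \<inter> T" by blast
      then show False unfolding triv by simp
    qed
    then show ?thesis
      using subgroup.one_closed[OF T] by (auto simp: Hol.base_def carrier_Z8)
  qed
  with T have "card T \<le> card (auto Z8)"
    using Hol.card_le_of_trivial_Int_base fin by (simp add: carrier_AutoGroup)
  moreover have "card (carrier Hol.P) \<le> card K * card T"
  proof -
    have "finite K" "finite T"
      using finP K T subgroup.subset finite_subset by metis+
    moreover have "carrier Hol.P \<subseteq> (\<lambda>(a, b). a \<otimes>\<^bsub>Hol.P\<^esub> b) ` (K \<times> T)"
      unfolding KT set_mult_def by blast
    ultimately have "card (carrier Hol.P) \<le> card (K \<times> T)"
      by (intro surj_card_le) auto
    then show ?thesis
      by (simp only: card_cartesian_product)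
  qed
  moreover have "card (carrier Hol.P) = 8 * card (auto Z8)"
    by (simp add: card_cartesian_product carrier_Z8 carrier_AutoGroup)
  moreover have "card (auto Z8) > 0"
    using finite_auto_Z8 neg8_auto card_gt_0_iff by blast
  ultimately have "8 * card (auto Z8) \<le> card K * card (auto Z8)"
    using mult_le_mono2[of "card T" "card (auto Z8)" "card K"] by linarith
  with small \<open>card (auto Z8) > 0\<close> show False by simp
qed

lemma (in group) subgroup_commuting_involutions:
  assumes x: "x \<in> carrier G" "x \<otimes> x = \<one>" and z: "z \<in> carrier G" "z \<otimes> z = \<one>"
    and comm: "z \<otimes> x = x \<otimes> z"
  shows "subgroup {\<one>, z, x, x \<otimes> z} G"
proof -
  have xxz: "x \<otimes> (x \<otimes> z) = z" and zxz: "z \<otimes> (x \<otimes> z) = x"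
    and xzx: "x \<otimes> z \<otimes> x = z" and xzz: "x \<otimes> z \<otimes> z = x"
    and xzxz: "x \<otimes> z \<otimes> (x \<otimes> z) = \<one>"
    using x z comm by (metis m_assoc m_closed l_one r_one)+
  show ?thesis
  proof (rule subgroupI)
    show "inv a \<in> {\<one>, z, x, x \<otimes> z}" if "a \<in> {\<one>, z, x, x \<otimes> z}" for a
    proof -
      have "a \<otimes> a = \<one>" "a \<in> carrier G"
        using that x z xzxz by auto
      then show ?thesis using that by (simp add: inv_equality)
    qed
  qed (use x z xxz zxz xzx xzz xzxz comm in auto)
qed

text \<open>
  If \<open>x\<close> were outside \<open>H\<close>, the subgroup \<open>{1, z, x, xz}\<close> with \<open>z = (4, id)\<close> would not be contained
  in \<open>H\<close>. It has at most \<open>4\<close> elements, one of which is \<open>z\<close>, so it cannot be complemented.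
\<close>

lemma involution_in_C_separating:
  assumes sep: "C_separating_subgroup H (holomorph Z8)"
    and x: "x \<in> carrier Hol.P" "x \<otimes>\<^bsub>Hol.P\<^esub> x = \<one>\<^bsub>Hol.P\<^esub>"
  shows "x \<in> H"
proof (rule ccontr)
  assume "x \<notin> H"
  let ?z = "(4 :: int, \<one>\<^bsub>AutoGroup Z8\<^esub>)"
  let ?K = "{\<one>\<^bsub>Hol.P\<^esub>, ?z, x, x \<otimes>\<^bsub>Hol.P\<^esub> ?z}"
  have z: "?z \<in> carrier Hol.P"
    by (simp add: carrier_Z8)
  have zz: "?z \<otimes>\<^bsub>Hol.P\<^esub> ?z = \<one>\<^bsub>Hol.P\<^esub>"
    by (simp add: carrier_Z8)
  have comm: "?z \<otimes>\<^bsub>Hol.P\<^esub> x = x \<otimes>\<^bsub>Hol.P\<^esub> ?z"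
    using x(1) auto_Z8_fixes_4[of "snd x"]
    by (cases x) (auto simp: carrier_AutoGroup add.commute)
  have "subgroup ?K Hol.P"
    using x z zz comm by (rule Hol.P.subgroup_commuting_involutions)
  with \<open>x \<notin> H\<close> have "complemented_in ?K (holomorph Z8)"
    using sep unfolding C_separating_subgroup_def holomorph_def by blast
  moreover have "card ?K < 8"
    by (rule le_less_trans[OF card_insert_le_m1[where n = 4]])
      (auto intro!: le_trans[OF card_insert_le_m1])
  ultimately show False
    using not_complemented_if_contains_4[of ?K] by blast
qed

text \<open>
  The elements \<open>(0, f)\<close> and \<open>(1, neg8)\<close> square to the identity and generate the holomorph, so a
  C-separating subgroup would not be proper.
\<close>

lemma holomorph_Z8_notin_class_X: "holomorph Z8 \<notin> class_X"
proof
  let ?e = "\<one>\<^bsub>AutoGroup Z8\<^esub>"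
  assume "holomorph Z8 \<in> class_X"
  then obtain H where sep: "C_separating_subgroup H (holomorph Z8)"
    by (auto simp: class_X_def)
  then have H: "subgroup H Hol.P" and ne: "H \<noteq> carrier Hol.P"
    by (simp_all add: C_separating_subgroup_def holomorph_def)
  have aut: "(0, f) \<in> H" if f: "f \<in> auto Z8" for f
    using f AutoGroup_Z8_involutions[OF f] auto_Z8_eq_mult[OF f, of 0]
    by (intro involution_in_C_separating[OF sep]) (auto simp: carrier_AutoGroup carrier_Z8)
  have "(1, neg8) \<in> H"
    using neg8_auto AutoGroup_Z8_involutions[OF neg8_auto]
    by (intro involution_in_C_separating[OF sep]) (auto simp: carrier_AutoGroup carrier_Z8 neg8_def)
  then have "(1, neg8) \<otimes>\<^bsub>Hol.P\<^esub> (0, neg8) \<in> H"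
    using aut[OF neg8_auto] subgroup.m_closed[OF H] by blast
  then have gen: "(1, ?e) \<in> H"
    using AutoGroup_Z8_involutions[OF neg8_auto] by (simp add: neg8_def)
  interpret i: group_hom Z8 Hol.P "\<lambda>n. (n, ?e)"
    by unfold_locales (rule Hol.inj_hom)
  have "(n, f) \<in> H" if n: "n \<in> {0..<8}" and f: "f \<in> auto Z8" for n f
  proof -
    have "(1, ?e) [^]\<^bsub>Hol.P\<^esub> n = (1 [^]\<^bsub>Z8\<^esub> n, ?e)"
      by (rule i.hom_int_pow[symmetric]) simp
    also have "\<dots> = (n, ?e)"
      using n by (simp add: int_pow_integer_mod_group)
    finally have "(n, ?e) \<in> H"
      using Hol.P.subgroup_int_pow_closed[OF H gen, of n] by simp
    then have "(n, ?e) \<otimes>\<^bsub>Hol.P\<^esub> (0, f) \<in> H"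
      using aut[OF f] subgroup.m_closed[OF H] by blast
    then show ?thesis
      using n f Hol.Q.l_one[of f] Hol.act_one_Q[of 0] by (simp add: carrier_AutoGroup)
  qed
  then have "carrier Hol.P \<subseteq> H"
    by (auto simp: carrier_Z8 carrier_AutoGroup)
  with ne subgroup.subset[OF H] show False by blast
qed

theorem theorem4:
  shows "(class_X :: ('a, 'b) monoid_scheme set) \<subseteq> class_Y \<and>
         holomorph (integer_mod_group 8) \<in> class_Y - class_X"
  using class_X_subset_class_Y holomorph_Z8_in_class_Y holomorph_Z8_notin_class_X by blast

end
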